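(* Let $n\ge 1$. The set of axioms $\mathit{Md}\cup\mathit{DE}$ is a finite basis (a complete axiomatisation) of the class $\mathrm{Mod}_{\Sigma_{md}}(\mathit{Md}\cup\mathit{DE}\cup\{\mathit{IL}\})$ of all $\Sigma_{md}$-algebras satisfying $\mathit{Md}$, $\mathit{DE}$ and $\mathit{IL}$. That is, $\mathit{Md}\cup\mathit{DE}$ is a finite set of equations such that for every pair of terms $t,r$ over $\Sigma_{md}$ (possibly containing variables), $\mathit{Md}\cup\mathit{DE}\vdash t=r$ in equational logic if and only if the equation $t=r$ is valid in every algebra in $\mathrm{Mod}_{\Sigma_{md}}(\mathit{Md}\cup\mathit{DE}\cup\{\mathit{IL}\})$.
   Context: The signature of meadows is $\Sigma_m=(0,1,+,\cdot,-,{}^{-1})$, with constants $0,1$, binary operations $+,\cdot$, and unary operations $-$ and ${}^{-1}$. For the fixed $n\ge1$, the signature $\Sigma_{md}$ extends $\Sigma_m$ with constants $X_1,\dots,X_n$ and unary operations $\frac{\partial}{\partial X_1},\dots,\frac{\partial}{\partial X_n}$. $\mathit{Md}$ is the following set of equations (variables $x,y,z$ are implicitly universally quantified): $(x+y)+z=x+(y+z)$; $x+y=y+x$; $x+0=x$; $x+(-x)=0$; $(x\cdot y)\cdot z=x\cdot(y\cdot z)$; $x\cdot y=y\cdot x$; $1\cdot x=x$; $x\cdot(y+z)=x\cdot y+x\cdot z$; $(x^{-1})^{-1}=x$; $x\cdot(x\cdot x^{-1})=x$. $\mathit{DE}$ is the following set of equations, for all $i,j\in\{1,\dots,n\}$: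 (D1) $\frac{\partial}{\partial X_i}(x+y)=\frac{\partial}{\partial X_i}(x)+\frac{\partial}{\partial X_i}(y)$; (D2) $\frac{\partial}{\partial X_i}(x\cdot y)=\frac{\partial}{\partial X_i}(x)\cdot y+x\cdot\frac{\partial}{\partial X_i}(y)$; (D3) $\frac{\partial}{\partial X_i}(x\cdot x^{-1})=0$; (D4) $\frac{\partial}{\partial X_i}(X_i)=1$; (D5) $\frac{\partial}{\partial X_i}(X_j)=0$ if $i\ne j$. $\mathit{IL}$ (Inverse Law) is the conditional formula $x\neq 0\Longrightarrow x\cdot x^{-1}=1$ (universally quantified over $x$). $\mathit{Md}\cup\mathit{DE}\vdash t=r$ denotes derivability in equational logic (reflexivity, symmetry, transitivity, congruence for all operations of $\Sigma_{md}$, and substitution). *)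

theory Defs
  imports Main
begin

text \<open>
  The indices \<open>1, \<dots>, n\<close> are the elements of a finite type \<open>'n\<close>; since types are nonempty,
  \<open>n = card (UNIV :: 'n set) \<ge> 1\<close>. Variables are natural numbers.
\<close>

datatype 'n tm =
    Var nat
  | Zero
  | One
  | Add "'n tm" "'n tm"
  | Mul "'n tm" "'n tm"
  | Neg "'n tm"
  | Inv "'n tm"
  | Ind 'n                  \<comment> \<open>the constant \<open>X\<^sub>i\<close>\<close>
  | PD 'n "'n tm"           \<comment> \<open>the operation \<open>\<partial>/\<partial>X\<^sub>i\<close>\<close>

type_synonym 'n eqn = "'n tm \<times> 'n tm"

primrec subst :: "(nat \<Rightarrow> 'n tm) \<Rightarrow> 'n tm \<Rightarrow> 'n tm" where
  "subst \<sigma> (Var v) = \<sigma> v"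
| "subst \<sigma> Zero = Zero"
| "subst \<sigma> One = One"
| "subst \<sigma> (Add s t) = Add (subst \<sigma> s) (subst \<sigma> t)"
| "subst \<sigma> (Mul s t) = Mul (subst \<sigma> s) (subst \<sigma> t)"
| "subst \<sigma> (Neg t) = Neg (subst \<sigma> t)"
| "subst \<sigma> (Inv t) = Inv (subst \<sigma> t)"
| "subst \<sigma> (Ind i) = Ind i"
| "subst \<sigma> (PD i t) = PD i (subst \<sigma> t)"

inductive derivable :: "'n eqn set \<Rightarrow> 'n tm \<Rightarrow> 'n tm \<Rightarrow> bool"  ("(_/ \<turnstile> _/ \<approx> _)" [51, 51, 51] 50)
  for E :: "'n eqn set"
where
  ax: "(s, t) \<in> E \<Longrightarrow> E \<turnstile> s \<approx> t"
| refl: "E \<turnstile> t \<approx> t"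
| sym: "E \<turnstile> s \<approx> t \<Longrightarrow> E \<turnstile> t \<approx> s"
| trans: "E \<turnstile> s \<approx> t \<Longrightarrow> E \<turnstile> t \<approx> u \<Longrightarrow> E \<turnstile> s \<approx> u"
| cong_Add: "E \<turnstile> s \<approx> s' \<Longrightarrow> E \<turnstile> t \<approx> t' \<Longrightarrow> E \<turnstile> Add s t \<approx> Add s' t'"
| cong_Mul: "E \<turnstile> s \<approx> s' \<Longrightarrow> E \<turnstile> t \<approx> t' \<Longrightarrow> E \<turnstile> Mul s t \<approx> Mul s' t'"
| cong_Neg: "E \<turnstile> t \<approx> t' \<Longrightarrow> E \<turnstile> Neg t \<approx> Neg t'"
| cong_Inv: "E \<turnstile> t \<approx> t' \<Longrightarrow> E \<turnstile> Inv t \<approx> Inv t'"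
| cong_PD: "E \<turnstile> t \<approx> t' \<Longrightarrow> E \<turnstile> PD i t \<approx> PD i t'"
| subst: "E \<turnstile> s \<approx> t \<Longrightarrow> E \<turnstile> subst \<sigma> s \<approx> subst \<sigma> t"

definition Md :: "'n eqn set" where
  "Md = (let x = Var 0; y = Var 1; z = Var 2 in
    {(Add (Add x y) z, Add x (Add y z)),
     (Add x y, Add y x),
     (Add x Zero, x),
     (Add x (Neg x), Zero),
     (Mul (Mul x y) z, Mul x (Mul y z)),
     (Mul x y, Mul y x),
     (Mul One x, x),
     (Mul x (Add y z), Add (Mul x y) (Mul x z)),
     (Inv (Inv x), x),
     (Mul x (Mul x (Inv x)), x)})"

definition DE :: "'n eqn set" where
  "DE = (let x = Var 0; y = Var 1 in
     {(PD i (Add x y), Add (PD i x) (PD i y)) | i. True}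
   \<union> {(PD i (Mul x y), Add (Mul (PD i x) y) (Mul x (PD i y))) | i. True}
   \<union> {(PD i (Mul x (Inv x)), Zero) | i. True}
   \<union> {(PD i (Ind i), One) | i. True}
   \<union> {(PD i (Ind j), Zero) | i j. i \<noteq> j})"

record ('a, 'n) algebra =
  carrier :: "'a set"
  zero :: 'a
  one :: 'a
  add :: "'a \<Rightarrow> 'a \<Rightarrow> 'a"
  mul :: "'a \<Rightarrow> 'a \<Rightarrow> 'a"
  neg :: "'a \<Rightarrow> 'a"
  inv :: "'a \<Rightarrow> 'a"
  ind :: "'n \<Rightarrow> 'a"
  pd :: "'n \<Rightarrow> 'a \<Rightarrow> 'a"

definition is_algebra :: "('a, 'n) algebra \<Rightarrow> bool" where
  "is_algebra A \<longleftrightarrow>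
     zero A \<in> carrier A \<and> one A \<in> carrier A \<and>
     (\<forall>a\<in>carrier A. \<forall>b\<in>carrier A. add A a b \<in> carrier A \<and> mul A a b \<in> carrier A) \<and>
     (\<forall>a\<in>carrier A. neg A a \<in> carrier A \<and> inv A a \<in> carrier A) \<and>
     (\<forall>i. ind A i \<in> carrier A) \<and>
     (\<forall>i. \<forall>a\<in>carrier A. pd A i a \<in> carrier A)"

primrec interp :: "('a, 'n) algebra \<Rightarrow> (nat \<Rightarrow> 'a) \<Rightarrow> 'n tm \<Rightarrow> 'a" where
  "interp A \<rho> (Var v) = \<rho> v"
| "interp A \<rho> Zero = zero A"
| "interp A \<rho> One = one A"
| "interp A \<rho> (Add s t) = add A (interp A \<rho> s) (interp A \<rho> t)"
| "interp A \<rho> (Mul s t) = mul A (interp A \<rho> s) (interp A \<rho> t)"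
| "interp A \<rho> (Neg t) = neg A (interp A \<rho> t)"
| "interp A \<rho> (Inv t) = inv A (interp A \<rho> t)"
| "interp A \<rho> (Ind i) = ind A i"
| "interp A \<rho> (PD i t) = pd A i (interp A \<rho> t)"

definition valid :: "('a, 'n) algebra \<Rightarrow> 'n eqn \<Rightarrow> bool" where
  "valid A e \<longleftrightarrow>
     (\<forall>\<rho>. (\<forall>v. \<rho> v \<in> carrier A) \<longrightarrow> interp A \<rho> (fst e) = interp A \<rho> (snd e))"

text \<open>The trivial algebra (\<open>0 = 1\<close>) satisfies the inverse law.\<close>

definition satisfies_IL :: "('a, 'n) algebra \<Rightarrow> bool" where
  "satisfies_IL A \<longleftrightarrow> (\<forall>a\<in>carrier A. a \<noteq> zero A \<longrightarrow> mul A a (inv A a) = one A)"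

definition Mod_IL :: "'n eqn set \<Rightarrow> ('a, 'n) algebra set" where
  "Mod_IL E = {A. is_algebra A \<and> (\<forall>e\<in>E. valid A e) \<and> satisfies_IL A}"

text \<open>
  A set \<open>K\<close> of algebras contains only algebras whose carrier is a subset of the type \<open>'a\<close>.
  An isomorphism-closed class of arbitrary algebras is represented by its members
  on a type \<open>'a\<close>. When \<open>'a\<close> is infinite, these include isomorphic copies of all finite and
  countable members of the class; a type of larger cardinality covers larger ones.
\<close>

definition finite_basis :: "'n eqn set \<Rightarrow> ('a, 'n) algebra set \<Rightarrow> bool" where
  "finite_basis E K \<longleftrightarrow>
     finite E \<and> (\<forall>t r. E \<turnstile> t \<approx> r \<longleftrightarrow> (\<forall>A\<in>K. valid A (t, r)))"

end

theory Submission
  imports Defs "HOL-Library.Countable_Set"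
begin

text \<open>
  The free algebra on countably many variables is a commutative von Neumann regular ring, so if
  \<open>s = t - r\<close> is nonzero in it, then so is the idempotent \<open>e = s \<cdot> s\<^sup>-\<^sup>1\<close>. An ideal \<open>M\<close> maximal among
  those avoiding \<open>e\<close> is prime, and \<open>x \<cdot> (1 - x \<cdot> x\<^sup>-\<^sup>1) = 0\<close> shows that the quotient by \<open>M\<close> satisfies
  the inverse law. The axiom \<open>\<partial>(x \<cdot> x\<^sup>-\<^sup>1) = 0\<close> makes every ideal closed under the derivations:
  \<open>\<partial>x = \<partial>(x \<cdot> (x \<cdot> x\<^sup>-\<^sup>1)) = \<partial>x \<cdot> x \<cdot> x\<^sup>-\<^sup>1\<close>. Hence the quotient is a model in which \<open>t \<noteq> r\<close>.
\<close>

section \<open>Prime ideals\<close>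

definition ideal :: "'a::comm_ring set \<Rightarrow> bool" where
  "ideal M \<longleftrightarrow> 0 \<in> M \<and> (\<forall>x\<in>M. \<forall>y\<in>M. x + y \<in> M) \<and> (\<forall>x\<in>M. \<forall>r. r * x \<in> M)"

lemma idealI:
  assumes "0 \<in> M" "\<And>x y. x \<in> M \<Longrightarrow> y \<in> M \<Longrightarrow> x + y \<in> M" "\<And>x r. x \<in> M \<Longrightarrow> r * x \<in> M"
  shows "ideal M"
  using assms by (auto simp: ideal_def)

lemma ideal_zero: "ideal M \<Longrightarrow> 0 \<in> M"
  and ideal_add: "ideal M \<Longrightarrow> x \<in> M \<Longrightarrow> y \<in> M \<Longrightarrow> x + y \<in> M"
  and ideal_mult_left: "ideal M \<Longrightarrow> x \<in> M \<Longrightarrow> r * x \<in> M"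
  and ideal_mult_right: "ideal M \<Longrightarrow> x \<in> M \<Longrightarrow> x * r \<in> M"
  by (auto simp: ideal_def mult.commute)

lemma ideal_uminus:
  fixes M :: "'a::{comm_ring,comm_monoid_mult} set"
  assumes "ideal M" "x \<in> M"
  shows "- x \<in> M"
  using ideal_mult_left[OF assms, of "- 1"] by simp

lemma ideal_diff:
  fixes M :: "'a::{comm_ring,comm_monoid_mult} set"
  assumes "ideal M" "x \<in> M" "y \<in> M"
  shows "x - y \<in> M"
  using ideal_add[OF assms(1,2) ideal_uminus[OF assms(1,3)]] by simp

text \<open>With a unit this ideal contains \<open>a\<close>, so when \<open>a\<close> is outside
  \<open>M\<close> it strictly enlarges \<open>M\<close>; this is how maximality of \<open>M\<close>
  is exploited.\<close>

lemma ideal_adjoin: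
  assumes "ideal M"
  shows "ideal {m + r * a | m r. m \<in> M}" (is "ideal ?J")
proof (rule idealI)
  have "0 = 0 + 0 * a" by simp
  then show "0 \<in> ?J" using ideal_zero[OF assms] by blast
next
  fix x y assume "x \<in> ?J" "y \<in> ?J"
  then obtain m r m' r' where "m \<in> M" "m' \<in> M" "x = m + r * a" "y = m' + r' * a" by blast
  moreover from this have "x + y = (m + m') + (r + r') * a" by (simp add: algebra_simps)
  ultimately show "x + y \<in> ?J" using ideal_add[OF assms] by blast
next
  fix x s assume "x \<in> ?J"
  then obtain m r where "m \<in> M" "x = m + r * a" by blast
  moreover from this have "s * x = s * m + (s * r) * a" by (simp add: algebra_simps)
  ultimately show "s * x \<in> ?J" using ideal_mult_left[OF assms] by blast
qed

text \<open>Idempotence makes {e} multiplicatively closed. If \<open>a\<close> and \<open>b\<close>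
  lie outside an \<open>M\<close> maximal among the ideals avoiding \<open>e\<close>, then
  \<open>e\<close> lies in both M + (a) and M + (b), hence e = e * e lies in M + (a * b), and
  \<open>a * b\<close> cannot be in \<open>M\<close>.\<close>

lemma idempotent_avoiding_prime_ideal:
  fixes e :: "'a::{comm_ring,comm_monoid_mult}"
  assumes idem: "e * e = e" and "e \<noteq> 0"
  obtains M where "ideal M" "e \<notin> M" "\<And>a b. a * b \<in> M \<Longrightarrow> a \<in> M \<or> b \<in> M"
proof -
  let ?I = "{M. ideal M \<and> e \<notin> M}"
  have "\<exists>M\<in>?I. \<forall>X\<in>?I. M \<subseteq> X \<longrightarrow> X = M"
  proof (rule subset_Zorn_nonempty)
    have "ideal {0::'a}" by (rule idealI) auto
    then show "?I \<noteq> {}" using \<open>e \<noteq> 0\<close> by blast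
  next
    fix C assume C: "C \<noteq> {}" "subset.chain ?I C"
    have "ideal (\<Union>C)"
    proof (rule idealI)
      show "0 \<in> \<Union>C" using C by (fastforce simp: subset_chain_def dest: ideal_zero)
    next
      fix x y assume "x \<in> \<Union>C" "y \<in> \<Union>C"
      then obtain I where "I \<in> C" "x \<in> I" "y \<in> I"
        using C(2) by (fastforce simp: subset_chain_def)
      then show "x + y \<in> \<Union>C" using C(2) by (auto simp: subset_chain_def intro: ideal_add)
    next
      fix x r assume "x \<in> \<Union>C"
      then show "r * x \<in> \<Union>C" using C(2) by (auto simp: subset_chain_def intro: ideal_mult_left)
    qed
    then show "\<Union>C \<in> ?I" using C(2) by (auto simp: subset_chain_def)
  qed
  then obtain M where M: "ideal M" "e \<notin> M"
    and max: "\<And>X. ideal X \<Longrightarrow> e \<notin> X \<Longrightarrow> M \<subseteq> X \<Longrightarrow> X = M" by blast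
  have adjoin: "\<exists>m\<in>M. \<exists>r. e = m + r * a" if "a \<notin> M" for a
  proof (rule ccontr)
    let ?J = "{m + r * a | m r. m \<in> M}"
    assume "\<not> ?thesis"
    then have "e \<notin> ?J" by blast
    moreover have "M \<subseteq> ?J"
    proof
      fix m assume "m \<in> M"
      moreover have "m = m + 0 * a" by simp
      ultimately show "m \<in> ?J" by blast
    qed
    ultimately have "?J = M" using max ideal_adjoin[OF M(1)] by blast
    moreover have "a = 0 + 1 * a" by simp
    ultimately show False using that ideal_zero[OF M(1)] by blast
  qed
  have "a \<in> M \<or> b \<in> M" if "a * b \<in> M" for a b
  proof (rule ccontr)
    assume "\<not> ?thesis"
    then obtain m r m' r' where *: "m \<in> M" "m' \<in> M" "e = m + r * a" "e = m' + r' * b"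
      using adjoin by meson
    then have "e = (m + r * a) * (m' + r' * b)" using idem by simp
    \<comment> \<open>Every summand except the last carries a factor \<open>m\<close> or
      \<open>m'\<close>.\<close>
    also have "\<dots> = (m * (m' + r' * b) + (r * a) * m') + (r * r') * (a * b)"
      by (simp add: algebra_simps)
    also have "\<dots> \<in> M"
      by (rule ideal_add[OF M(1) ideal_add[OF M(1)]])
        (rule ideal_mult_right[OF M(1) *(1)] ideal_mult_left[OF M(1) *(2)]
          ideal_mult_left[OF M(1) that])+
    finally show False using M(2) by simp
  qed
  with M that show thesis by blast
qed

section \<open>The free algebra\<close>

abbreviation MdDE :: "'n eqn set" where
  "MdDE \<equiv> Md \<union> DE"

\<comment> \<open>Equality here is provable equality, so an underivable equation already fails; the
  inverse law is enforced by a further quotient.\<close>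
quotient_type 'n free_alg = "'n tm" / "derivable (MdDE :: 'n eqn set)"
  by (rule equivpI)
    (auto simp: reflp_def symp_def transp_def intro: derivable.refl derivable.sym derivable.trans)

section \<open>Term instances of the axioms\<close>

lemma derivable_axiom:
  fixes s t :: "'n tm"
  assumes "(s, t) \<in> Md \<union> DE"
  shows "MdDE \<turnstile> subst \<sigma> s \<approx> subst \<sigma> t"
  using assms by (intro derivable.subst derivable.ax)

text \<open>The axioms mention only the variables 0, 1 and 2, so one substitution yields all their
  instances.\<close>

fun subst3 :: "'n tm \<Rightarrow> 'n tm \<Rightarrow> 'n tm \<Rightarrow> nat \<Rightarrow> 'n tm" where
  "subst3 x y z v = (if v = 0 then x else if v = 1 then y else z)"

lemma Md_axioms:
  "(Add (Add (Var 0) (Var 1)) (Var 2), Add (Var 0) (Add (Var 1) (Var 2))) \<in> Md"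
  "(Add (Var 0) (Var 1), Add (Var 1) (Var 0)) \<in> Md"
  "(Add (Var 0) Zero, Var 0) \<in> Md"
  "(Add (Var 0) (Neg (Var 0)), Zero) \<in> Md"
  "(Mul (Mul (Var 0) (Var 1)) (Var 2), Mul (Var 0) (Mul (Var 1) (Var 2))) \<in> Md"
  "(Mul (Var 0) (Var 1), Mul (Var 1) (Var 0)) \<in> Md"
  "(Mul One (Var 0), Var 0) \<in> Md"
  "(Mul (Var 0) (Add (Var 1) (Var 2)), Add (Mul (Var 0) (Var 1)) (Mul (Var 0) (Var 2))) \<in> Md"
  "(Inv (Inv (Var 0)), Var 0) \<in> Md"
  "(Mul (Var 0) (Mul (Var 0) (Inv (Var 0))), Var 0) \<in> Md"
  by (simp_all add: Md_def Let_def)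

lemma DE_axioms:
  "(PD i (Add (Var 0) (Var 1)), Add (PD i (Var 0)) (PD i (Var 1))) \<in> DE"
  "(PD i (Mul (Var 0) (Var 1)),
    Add (Mul (PD i (Var 0)) (Var 1)) (Mul (Var 0) (PD i (Var 1)))) \<in> DE"
  "(PD i (Mul (Var 0) (Inv (Var 0))), Zero) \<in> DE"
  by (auto simp: DE_def Let_def)

lemma Md_derivable:
  fixes x y z :: "'n tm"
  shows "MdDE \<turnstile> Add (Add x y) z \<approx> Add x (Add y z)"
    and "MdDE \<turnstile> Add x y \<approx> Add y x"
    and "MdDE \<turnstile> Add x Zero \<approx> x"
    and "MdDE \<turnstile> Add x (Neg x) \<approx> Zero"
    and "MdDE \<turnstile> Mul (Mul x y) z \<approx> Mul x (Mul y z)"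
    and "MdDE \<turnstile> Mul x y \<approx> Mul y x"
    and "MdDE \<turnstile> Mul One x \<approx> x"
    and "MdDE \<turnstile> Mul x (Add y z) \<approx> Add (Mul x y) (Mul x z)"
    and "MdDE \<turnstile> Inv (Inv x) \<approx> x"
    and "MdDE \<turnstile> Mul x (Mul x (Inv x)) \<approx> x"
  using Md_axioms[THEN UnI1, THEN derivable_axiom, of "subst3 x y z"] by simp_all

lemma DE_derivable:
  fixes x y :: "'n tm"
  shows "MdDE \<turnstile> PD i (Add x y) \<approx> Add (PD i x) (PD i y)"
    and "MdDE \<turnstile> PD i (Mul x y) \<approx> Add (Mul (PD i x) y) (Mul x (PD i y))"
    and "MdDE \<turnstile> PD i (Mul x (Inv x)) \<approx> Zero"
  \<comment> \<open>These axioms contain only the variables 0 and 1; the second \<open>y\<close> is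
    a filler.\<close>
  using DE_axioms[where i = i, THEN UnI2, THEN derivable_axiom, of "subst3 x y y"] by simp_all

text \<open>This sort describes commutative rings with unit that may be trivial;
  \<open>comm_ring_1\<close> would demand a proof that \<open>Zero\<close> and \<open>One\<close>
  are not provably equal.\<close>

instantiation free_alg :: (type) "{comm_ring,comm_monoid_mult}"
begin

lift_definition zero_free_alg :: "'a free_alg" is Zero .
lift_definition one_free_alg :: "'a free_alg" is One .
lift_definition plus_free_alg :: "'a free_alg \<Rightarrow> 'a free_alg \<Rightarrow> 'a free_alg" is Add
  by (rule derivable.cong_Add)
lift_definition times_free_alg :: "'a free_alg \<Rightarrow> 'a free_alg \<Rightarrow> 'a free_alg" is Mul
  by (rule derivable.cong_Mul)
lift_definition uminus_free_alg :: "'a free_alg \<Rightarrow> 'a free_alg" is Neg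
  by (rule derivable.cong_Neg)
definition minus_free_alg :: "'a free_alg \<Rightarrow> 'a free_alg \<Rightarrow> 'a free_alg" where
  "minus_free_alg x y = x + - y"

instance
proof
  fix a b c :: "'a free_alg"
  show "a + b + c = a + (b + c)" by transfer (rule Md_derivable)
  show comm: "x + y = y + x" for x y :: "'a free_alg" by transfer (rule Md_derivable)
  have "a + 0 = a" by transfer (rule Md_derivable)
  then show "0 + a = a" by (simp add: comm)
  have "a + - a = 0" by transfer (rule Md_derivable)
  then show "- a + a = 0" by (simp add: comm)
  show "a - b = a + - b" by (rule minus_free_alg_def)
  show "a * b * c = a * (b * c)" by transfer (rule Md_derivable)
  show mcomm: "x * y = y * x" for x y :: "'a free_alg" by transfer (rule Md_derivable)
  show "1 * a = a" by transfer (rule Md_derivable)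
  have "c * (a + b) = c * a + c * b" by transfer (rule Md_derivable)
  then show "(a + b) * c = a * c + b * c" by (simp add: mcomm)
qed

end

lift_definition free_inv :: "'n free_alg \<Rightarrow> 'n free_alg" is Inv
  by (rule derivable.cong_Inv)
lift_definition free_ind :: "'n \<Rightarrow> 'n free_alg" is Ind .
lift_definition free_pd :: "'n \<Rightarrow> 'n free_alg \<Rightarrow> 'n free_alg" is PD
  by (rule derivable.cong_PD)

lemma mult_mult_free_inv: "x * (x * free_inv x) = x"
  by transfer (rule Md_derivable)

lemma free_inv_free_inv: "free_inv (free_inv x) = x"
  by transfer (rule Md_derivable)

lemma free_pd_add: "free_pd i (x + y) = free_pd i x + free_pd i y"
  by transfer (rule DE_derivable)

lemma free_pd_mult: "free_pd i (x * y) = free_pd i x * y + x * free_pd i y"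
  by transfer (rule DE_derivable)

lemma free_pd_idempotent: "free_pd i (x * free_inv x) = 0"
  by transfer (rule DE_derivable)

lemma free_pd_diff: "free_pd i (x - y) = free_pd i x - free_pd i y"
  using free_pd_add[of i "x - y" y] by simp

section \<open>Evaluation of terms in the free algebra\<close>

definition free_algebra :: "('n free_alg, 'n) algebra" where
  "free_algebra = \<lparr>carrier = UNIV, zero = 0, one = 1, add = (+), mul = (*), neg = uminus,
     inv = free_inv, ind = free_ind, pd = free_pd\<rparr>"

lemma interp_free_algebra:
  "interp free_algebra (\<lambda>v. abs_free_alg (\<sigma> v)) t = abs_free_alg (subst \<sigma> t)"
  by (induction t)
    (simp_all add: free_algebra_def zero_free_alg.abs_eq one_free_alg.abs_eq
      plus_free_alg.abs_eq times_free_alg.abs_eq uminus_free_alg.abs_eq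
      free_inv.abs_eq free_ind.abs_eq free_pd.abs_eq)

lemma subst_Var: "subst Var t = t"
  by (induction t) simp_all

text \<open>This is the generic assignment: an equation that is not derivable fails at it.\<close>

lemma interp_free_algebra_Var:
  "interp free_algebra (\<lambda>v. abs_free_alg (Var v)) t = abs_free_alg t"
  by (simp add: interp_free_algebra subst_Var)

text \<open>Choosing representatives turns an arbitrary assignment into a substitution, and
  derivability is closed under substitution.\<close>

lemma free_algebra_axiom:
  fixes \<rho> :: "nat \<Rightarrow> 'n free_alg"
  assumes "(s, t) \<in> Md \<union> DE"
  shows "interp free_algebra \<rho> s = interp free_algebra \<rho> t"
proof -
  define \<sigma> where "\<sigma> v = rep_free_alg (\<rho> v)" for v
  have "\<rho> = (\<lambda>v. abs_free_alg (\<sigma> v))"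
    by (simp add: \<sigma>_def Quotient_abs_rep[OF Quotient_free_alg])
  with derivable_axiom[OF assms, of \<sigma>] show ?thesis
    by (simp add: interp_free_algebra free_alg.abs_eq_iff)
qed

instance tm :: (countable) countable
  by countable_datatype

text \<open>Countability is what allows the countermodel to be placed inside an arbitrary infinite
  type.\<close>

lemma countable_free_alg: "countable (UNIV :: 'n::countable free_alg set)"
proof -
  have "(UNIV :: 'n free_alg set) = range abs_free_alg"
    using Quotient_abs_rep[OF Quotient_free_alg] by (metis surjI)
  then show ?thesis by (metis countable_image countableI_type)
qed

section \<open>Quotients of the free algebra\<close>

text \<open>Each of the two elements is a multiple of the other. Thus an ideal avoiding the
  idempotent of \<open>x\<close> also avoids \<open>x\<close>.\<close>

lemma ideal_idempotent_iff:
  assumes "ideal M"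
  shows "x * free_inv x \<in> M \<longleftrightarrow> x \<in> M"
  using ideal_mult_left[OF assms, of "x * free_inv x" x] ideal_mult_right[OF assms, of x]
  by (auto simp: mult_mult_free_inv)

lemma ideal_free_inv:
  assumes "ideal M" "x \<in> M"
  shows "free_inv x \<in> M"
proof -
  \<comment> \<open>Regularity at \<open>free_inv x\<close> exhibits it as a multiple of
    \<open>x\<close>.\<close>
  have "free_inv x = free_inv x * (free_inv x * x)"
    using mult_mult_free_inv[of "free_inv x"] by (simp add: free_inv_free_inv)
  with ideal_mult_left[OF assms(1)] assms(2) show ?thesis by metis
qed

text \<open>With \<open>free_pd_diff\<close> this lets the derivations descend to the quotient,
  which in a general differential ring requires a differential ideal.\<close>

lemma ideal_free_pd:
  assumes "ideal M" "x \<in> M"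
  shows "free_pd i x \<in> M"
proof -
  have "free_pd i x = free_pd i (x * (x * free_inv x))" by (simp add: mult_mult_free_inv)
  also have "\<dots> = free_pd i x * (x * free_inv x)"
    by (simp only: free_pd_mult[of i x "x * free_inv x"] free_pd_idempotent) simp
  also have "\<dots> \<in> M" using assms by (simp add: ideal_mult_left ideal_mult_right)
  finally show ?thesis .
qed

lemma free_inverse_law_mod:
  assumes "ideal M" "\<And>a b. a * b \<in> M \<Longrightarrow> a \<in> M \<or> b \<in> M" "x \<notin> M"
  shows "1 - x * free_inv x \<in> M"
proof -
  have "x * (1 - x * free_inv x) = 0" by (simp add: right_diff_distrib mult_mult_free_inv)
  with assms ideal_zero show ?thesis by metis
qed

text \<open>Either both elements lie in \<open>M\<close>, and then so do both inverses, or neither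
  does, and modulo \<open>M\<close> both have genuine inverses, which are unique.\<close>

lemma free_inv_cong_mod:
  assumes "ideal M" "\<And>a b. a * b \<in> M \<Longrightarrow> a \<in> M \<or> b \<in> M" and xy: "x - y \<in> M"
  shows "free_inv x - free_inv y \<in> M"
proof (cases "x \<in> M")
  case True
  then have "y \<in> M" using ideal_diff[OF assms(1) True xy] by simp
  with True assms(1) show ?thesis by (simp add: ideal_diff ideal_free_inv)
next
  case False
  then have "y \<notin> M" using ideal_add[OF assms(1) xy, of y] by auto
  let ?x = "free_inv x" and ?y = "free_inv y"
  \<comment> \<open>The identity 1/x - 1/y = -(x - y)/(xy), corrected by two terms that vanish
    modulo \<open>M\<close>.\<close>
  have "?x - ?y = ?x * (1 - y * ?y) - ?y * (1 - x * ?x) - (?x * ?y) * (x - y)"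
    by (simp add: algebra_simps)
  also have "\<dots> \<in> M"
  proof (intro ideal_diff[OF assms(1), of "_ - _"] ideal_diff[OF assms(1), of "_ * _"])
    show "?x * (1 - y * ?y) \<in> M" "?y * (1 - x * ?x) \<in> M"
      using assms(2) False \<open>y \<notin> M\<close>
      by (intro ideal_mult_left[OF assms(1)] free_inverse_law_mod[OF assms(1)]; blast)+
    show "?x * ?y * (x - y) \<in> M" by (rule ideal_mult_left[OF assms(1) xy])
  qed
  finally show ?thesis .
qed

section \<open>Transport of the quotient to the type \<open>'a\<close>\<close>

text \<open>\<open>f\<close> realises the quotient map of a prime ideal inside the given infinite type.\<close>

definition image_algebra :: "('n free_alg \<Rightarrow> 'a) \<Rightarrow> ('a, 'n) algebra" where
  "image_algebra f =
    (let h = inv_into UNIV f in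
     \<lparr>carrier = range f, zero = f 0, one = f 1, add = (\<lambda>a b. f (h a + h b)),
      mul = (\<lambda>a b. f (h a * h b)), neg = (\<lambda>a. f (- h a)), inv = (\<lambda>a. f (free_inv (h a))),
      ind = (\<lambda>i. f (free_ind i)), pd = (\<lambda>i a. f (free_pd i (h a)))\<rparr>)"

text \<open>The fibres of \<open>f\<close> are exactly the cosets of \<open>M\<close>; how
  \<open>f\<close> is built from representatives is left to the completeness proof.\<close>

locale prime_quotient =
  fixes M :: "'n free_alg set" and f :: "'n free_alg \<Rightarrow> 'a"
  assumes ideal: "ideal M"
    and prime: "a * b \<in> M \<Longrightarrow> a \<in> M \<or> b \<in> M"
    and f_eq_iff: "f x = f y \<longleftrightarrow> x - y \<in> M"
begin

text \<open>\<open>inv_into\<close> returns some member of the coset of \<open>x\<close>, so each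
  operation must be checked for independence of the representative.\<close>

lemma section_mod: "inv_into UNIV f (f x) - x \<in> M"
  using f_eq_iff by (simp flip: f_eq_iff add: f_inv_into_f)

lemma image_algebra_hom:
  "zero (image_algebra f) = f 0"
  "one (image_algebra f) = f 1"
  "add (image_algebra f) (f x) (f y) = f (x + y)"
  "mul (image_algebra f) (f x) (f y) = f (x * y)"
  "neg (image_algebra f) (f x) = f (- x)"
  "inv (image_algebra f) (f x) = f (free_inv x)"
  "ind (image_algebra f) i = f (free_ind i)"
  "pd (image_algebra f) i (f x) = f (free_pd i x)"
proof -
  let ?h = "inv_into UNIV f"
  have x: "?h (f x) - x \<in> M" and y: "?h (f y) - y \<in> M" by (rule section_mod)+
  have "?h (f x) + ?h (f y) - (x + y) = (?h (f x) - x) + (?h (f y) - y)"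
    by (simp add: algebra_simps)
  then have "?h (f x) + ?h (f y) - (x + y) \<in> M" using ideal_add[OF ideal x y] by metis
  then show "add (image_algebra f) (f x) (f y) = f (x + y)"
    by (simp add: image_algebra_def Let_def f_eq_iff)
  \<comment> \<open>Changing one factor at a time leaves a multiple of an element of
    \<open>M\<close> at each step.\<close>
  have "?h (f x) * ?h (f y) - x * y = (?h (f x) - x) * ?h (f y) + x * (?h (f y) - y)"
    by (simp add: algebra_simps)
  also have "\<dots> \<in> M"
    using ideal x y by (intro ideal_add ideal_mult_left ideal_mult_right)
  finally show "mul (image_algebra f) (f x) (f y) = f (x * y)"
    by (simp add: image_algebra_def Let_def f_eq_iff)
  show "neg (image_algebra f) (f x) = f (- x)"
    using ideal_uminus[OF ideal x] by (simp add: image_algebra_def Let_def f_eq_iff)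
  show "inv (image_algebra f) (f x) = f (free_inv x)"
    using free_inv_cong_mod[OF ideal prime x] by (simp add: image_algebra_def Let_def f_eq_iff)
  show "pd (image_algebra f) i (f x) = f (free_pd i x)"
    using ideal_free_pd[OF ideal x]
    by (simp add: image_algebra_def Let_def f_eq_iff free_pd_diff)
qed (simp_all add: image_algebra_def Let_def)

lemma carrier_image_algebra: "carrier (image_algebra f) = range f"
  by (simp add: image_algebra_def Let_def)

lemma interp_image_algebra:
  "interp (image_algebra f) (\<lambda>v. f (\<rho> v)) t = f (interp free_algebra \<rho> t)"
  by (induction t) (simp_all add: image_algebra_hom free_algebra_def)

text \<open>Assignments into \<open>range f\<close> lift along the homomorphism \<open>f\<close>, so
  equations are inherited from the free algebra; the inverse law comes from primality.\<close>

lemma image_algebra_in_Mod_IL: "image_algebra f \<in> Mod_IL (Md \<union> DE)"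
proof -
  have "is_algebra (image_algebra f)"
    by (auto simp: is_algebra_def carrier_image_algebra image_algebra_hom)
  moreover have "valid (image_algebra f) e" if "e \<in> Md \<union> DE" for e
    unfolding valid_def
  proof (intro allI impI)
    fix \<rho> :: "nat \<Rightarrow> 'a" assume "\<forall>v. \<rho> v \<in> carrier (image_algebra f)"
    then have "\<rho> = (\<lambda>v. f (inv_into UNIV f (\<rho> v)))"
      by (simp add: carrier_image_algebra f_inv_into_f)
    with free_algebra_axiom that show
      "interp (image_algebra f) \<rho> (fst e) = interp (image_algebra f) \<rho> (snd e)"
      by (metis interp_image_algebra prod.collapse)
  qed
  moreover have "satisfies_IL (image_algebra f)"
    unfolding satisfies_IL_def carrier_image_algebra
  proof (intro ballI impI)
    fix a assume "a \<in> range f" "a \<noteq> zero (image_algebra f)"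
    then obtain x where x: "a = f x" "f x \<noteq> f 0" by (auto simp: image_algebra_hom)
    then have "x \<notin> M" by (simp add: f_eq_iff)
    then have "f 1 = f (x * free_inv x)"
      using free_inverse_law_mod[OF ideal prime] by (simp add: f_eq_iff)
    then show "mul (image_algebra f) a (inv (image_algebra f) a) = one (image_algebra f)"
      by (simp add: x image_algebra_hom)
  qed
  ultimately show ?thesis by (simp add: Mod_IL_def)
qed

end

section \<open>Soundness and completeness\<close>

lemma interp_in_carrier:
  assumes "is_algebra A" "\<And>v. \<rho> v \<in> carrier A"
  shows "interp A \<rho> t \<in> carrier A"
  using assms by (induction t) (auto simp: is_algebra_def)

lemma interp_subst: "interp A \<rho> (subst \<sigma> t) = interp A (\<lambda>v. interp A \<rho> (\<sigma> v)) t"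
  by (induction t) simp_all

lemma derivable_sound:
  assumes "E \<turnstile> s \<approx> t" "is_algebra A" "\<forall>e\<in>E. valid A e"
  shows "valid A (s, t)"
  using assms
proof (induction rule: derivable.induct)
  \<comment> \<open>A substitution becomes a change of assignment, which stays inside the
    carrier.\<close>
  case (subst s t \<sigma>)
  then show ?case by (auto simp: valid_def interp_subst interp_in_carrier)
qed (auto simp: valid_def)

lemma derivable_complete:
  fixes t r :: "'n::countable tm"
  assumes "infinite (UNIV :: 'a set)"
    and valid: "\<And>A :: ('a, 'n) algebra. A \<in> Mod_IL (Md \<union> DE) \<Longrightarrow> valid A (t, r)"
  shows "Md \<union> DE \<turnstile> t \<approx> r"
proof (rule ccontr)
  assume "\<not> Md \<union> DE \<turnstile> t \<approx> r"
  then have "abs_free_alg t \<noteq> abs_free_alg r" by (simp add: free_alg.abs_eq_iff)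
  define s where "s = abs_free_alg t - abs_free_alg r"
  define e where "e = s * free_inv s"
  have "s \<noteq> 0" using \<open>abs_free_alg t \<noteq> abs_free_alg r\<close> by (simp add: s_def)
  \<comment> \<open>Regularity says s * e = s, so e = 0 would force s = 0.\<close>
  then have "e \<noteq> 0" using mult_mult_free_inv[of s] by (auto simp: e_def)
  have "e * e = (s * (s * free_inv s)) * free_inv s" by (simp add: e_def algebra_simps)
  then have "e * e = e" by (simp add: mult_mult_free_inv e_def)
  then obtain M where M: "ideal M" "e \<notin> M" "\<And>a b. a * b \<in> M \<Longrightarrow> a \<in> M \<or> b \<in> M"
    using idempotent_avoiding_prime_ideal \<open>e \<noteq> 0\<close> by blast
  obtain g :: "nat \<Rightarrow> 'a" where "inj g"
    using assms(1) infinite_countable_subset by blast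
  \<comment> \<open>For congruent arguments the predicates under \<open>SOME\<close> coincide, so
    \<open>c\<close> picks one fixed member of each coset.\<close>
  define c where "c x = (SOME y. x - y \<in> M)" for x
  have c: "x - c x \<in> M" for x
    unfolding c_def by (rule someI[of _ x]) (simp add: ideal_zero M)
  have c_iff: "c x = c y \<longleftrightarrow> x - y \<in> M" for x y
  proof
    assume "c x = c y"
    then have "x - y = (x - c x) - (y - c y)" by simp
    then show "x - y \<in> M" using ideal_diff[OF M(1) c c] by metis
  next
    assume xy: "x - y \<in> M"
    have "x - z \<in> M \<longleftrightarrow> y - z \<in> M" for z
      using ideal_diff[OF M(1) _ xy, of "x - z"] ideal_add[OF M(1) xy, of "y - z"] by auto
    then show "c x = c y" by (simp add: c_def)
  qed
  \<comment> \<open>The chosen coset representatives are numbered and then embedded into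
    \<open>'a\<close>.\<close>
  define f where "f x = g (to_nat_on UNIV (c x))" for x
  have "f x = f y \<longleftrightarrow> x - y \<in> M" for x y
    using \<open>inj g\<close> by (simp add: f_def inj_eq countable_free_alg c_iff)
  then interpret prime_quotient M f using M by unfold_locales
  \<comment> \<open>Validity is applied to the image under \<open>f\<close> of the generic
    assignment.\<close>
  have "f (abs_free_alg t) = f (abs_free_alg r)"
    using valid[OF image_algebra_in_Mod_IL]
      interp_image_algebra[of "\<lambda>v. abs_free_alg (Var v)"]
    by (simp add: valid_def carrier_image_algebra interp_free_algebra_Var)
      (metis (no_types, lifting) rangeI)
  then have "s \<in> M" by (simp add: f_eq_iff s_def)
  then show False using M(2) ideal_idempotent_iff[OF M(1)] by (simp add: e_def)
qed

section \<open>Finiteness of the axioms and conclusion\<close>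

lemma finite_Md: "finite Md"
  by (simp add: Md_def Let_def)

lemma finite_DE: "finite (DE :: 'n::finite eqn set)"
proof -
  have "finite {g i | i. True}" for g :: "'n \<Rightarrow> 'n eqn"
    by (simp add: full_SetCompr_eq)
  note this[of "\<lambda>i. (PD i (Add (Var 0) (Var 1)), Add (PD i (Var 0)) (PD i (Var 1)))"]
    this[of "\<lambda>i. (PD i (Mul (Var 0) (Var 1)),
      Add (Mul (PD i (Var 0)) (Var 1)) (Mul (Var 0) (PD i (Var 1))))"]
    this[of "\<lambda>i. (PD i (Mul (Var 0) (Inv (Var 0))), Zero)"]
    this[of "\<lambda>i. (PD i (Ind i), One)"]
  moreover have "finite {(PD i (Ind j), Zero) :: 'n eqn | i j. i \<noteq> j}"
    by (rule finite_subset[of _ "range (\<lambda>(i, j). (PD i (Ind j), Zero))"]) auto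
  ultimately show ?thesis unfolding DE_def Let_def by (intro finite_UnI)
qed

theorem corollary1:
  assumes "infinite (UNIV :: 'a set)"
  shows "finite_basis (Md \<union> DE :: ('n :: finite) eqn set)
           (Mod_IL (Md \<union> DE) :: ('a, 'n) algebra set)"
  unfolding finite_basis_def
proof (intro conjI allI iffI)
  show "finite (Md \<union> DE :: 'n eqn set)" by (simp add: finite_Md finite_DE)
  fix t r :: "'n tm"
  show "\<forall>A\<in>Mod_IL (Md \<union> DE) :: ('a, 'n) algebra set. valid A (t, r)" if "Md \<union> DE \<turnstile> t \<approx> r"
    using derivable_sound[OF that] by (auto simp: Mod_IL_def)
  show "Md \<union> DE \<turnstile> t \<approx> r"
    if "\<forall>A\<in>Mod_IL (Md \<union> DE) :: ('a, 'n) algebra set. valid A (t, r)"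
    \<comment> \<open>The finite index type is countable, as completeness requires.\<close>
    using derivable_complete[OF assms] that by blast
qed

end
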